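(* Under the aggregate no-overbidding (NOB) condition, the price of anarchy of pure Nash equilibria in the budget-free uniform price multi-unit auction is at least $-\mathcal W_{-1}(-e^{-2})\approx3.146$. That is, the supremum of $\mathrm{OPT}(I)/\mathrm{LW}(I,a)$ over all budget-free instances $I$ of the uniform price auction and all NOB-feasible pure Nash equilibria $a$ of $I$ is at least $-\mathcal W_{-1}(-e^{-2})$.
   Context: $\mathcal W_{-1}$ is the lower real branch of the Lambert function: $\mathcal W_{-1}(-e^{-2})$ is the unique $w\in(-\infty,-1]$ with $we^w=-e^{-2}$. Uniform price auction: bidders $N=[n]$, $n\ge2$, and $k\ge1$ identical units. Bidder $i$'s action is $a_i=(b_i,q_i)\in\mathbb R_{\ge0}\times\{0,1,\dots,k\}$: a per-unit bid and a demanded quantity. The marginal bids form the multiset containing $q_i$ copies of $b_i$ for each $i$. The $k$ units go to the $k$ highest marginal bids, ties resolved by a fixed deterministic rule that is part of the instance (if fewer than $k$ marginal bids are submitted, all of them win and the missing entries are treated as bids of $0$); $X_i(a)\in\{0,\dots,k\}$ is the number of units won by $i$. Let $\beta_0(a)$ be the highest losing marginal bid, i.e. the $(k+1)$-st highest, with $\beta_0(a)=0$ if $\sum_iq_i\le k$. Bidder $i$ pays $P_i(a)=\beta_0(a)X_i(a)$. Bidder $i$ has a concave valuation $v_i:\{0,1,\dots,k\}\to\mathbb R_{\ge0}$ with $v_i(0)=0$. Budget-free means all budgets are infinite. Utility: $u_i(a)=v_i(X_i(a))-P_i(a)$. A pure Nash equilibrium is a profile $a$ with $u_i(a)\ge u_i(a_i',a_{-i})$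 for all $i$ and all actions $a_i'$. In the budget-free case $\mathrm{LW}(I,a)=\sum_iv_i(X_i(a))$ and $\mathrm{OPT}(I)=\max\{\sum_iv_i(x_i):x\in\{0,\dots,k\}^n,\ \sum_ix_i\le k\}$. Aggregate NOB: let $W_i(a)=\sup\{P_i(a_i,a_{-i}'):X_i(a_i,a_{-i}')=X_i(a)\}$ (here $W_i(a)=b_iX_i(a)$). $a$ is NOB-feasible if $\sum_iW_i(a)\le\mathrm{LW}(I,a)$. Deviations are not restricted by NOB. *)

theory Defs
  imports "HOL-Analysis.Analysis" "HOL-Library.Multiset"
begin

section \<open>The lower real branch of the Lambert function\<close>

definition Lambert_Wm1 :: "real \<Rightarrow> real" where
  "Lambert_Wm1 x = (THE w. w \<le> -1 \<and> w * exp w = x)"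

lemma Lambert_Wm1_ex1: "\<exists>!w::real. w \<le> -1 \<and> w * exp w = - exp (-2)"
proof -
  define f where "f = (\<lambda>w::real. w * exp w)"
  have less: "f y < f x" if "x < y" "y \<le> -1" for x y
  proof (rule DERIV_neg_imp_decreasing_open[OF that(1)])
    fix z assume z: "x < z" "z < y"
    have "(f has_real_derivative (1 + z) * exp z) (at z)"
      unfolding f_def by (auto intro!: derivative_eq_intros simp: algebra_simps)
    moreover have "(1 + z) * exp z < 0"
      using z that(2) by (intro mult_neg_pos) auto
    ultimately show "\<exists>d. (f has_real_derivative d) (at z) \<and> d < 0" by blast
  next
    show "continuous_on {x..y} f" unfolding f_def by (intro continuous_intros)
  qed
  have lo: "f (-1) \<le> - exp (-2)" unfolding f_def by simp
  have "(2::real) ^ 4 \<le> (exp 1) ^ 4"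
    using exp_ge_add_one_self[of 1] by (intro power_mono) auto
  then have "6 \<le> exp (4::real)" by (simp flip: exp_of_nat_mult)
  then have "6 * exp (-6) \<le> exp 4 * exp (-(6::real))" by (intro mult_right_mono) auto
  then have hi: "- exp (-2) \<le> f (-6)" unfolding f_def by (simp flip: exp_add)
  have "\<exists>w\<ge>-6. w \<le> -1 \<and> f w = - exp (-2)"
    by (rule IVT2'[where f = f, OF lo hi]) (auto simp: f_def intro!: continuous_intros)
  then obtain w where w: "w \<le> -1" "f w = - exp (-2)" by blast
  show ?thesis
  proof (rule ex1I[of _ w])
    fix u :: real assume u: "u \<le> -1 \<and> u * exp u = - exp (-2)"
    then show "u = w" using less[of u w] less[of w u] w unfolding f_def
      by (cases u w rule: linorder_cases) auto
  qed (use w f_def in auto)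
qed


section \<open>The uniform price auction\<close>

text \<open>An action is a pair of a per-unit bid and a demanded quantity. The field \<open>alloc\<close> maps an
  action profile and a bidder to the number of units won; it carries the deterministic
  tie-breaking rule of the instance. There are no budgets.\<close>

type_synonym action = "real \<times> nat"
type_synonym profile = "nat \<Rightarrow> action"

record auction =
  num_bidders :: nat
  num_units :: nat
  val :: "nat \<Rightarrow> nat \<Rightarrow> real"
  alloc :: "profile \<Rightarrow> nat \<Rightarrow> nat"

definition bidders :: "auction \<Rightarrow> nat set" where
  "bidders I = {1..num_bidders I}"

definition actions :: "auction \<Rightarrow> action set" where
  "actions I = {(b, q). 0 \<le> b \<and> q \<le> num_units I}"

definition profiles :: "auction \<Rightarrow> profile set" where
  "profiles I = bidders I \<rightarrow>\<^sub>E actions I"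

definition marginal_bids :: "auction \<Rightarrow> profile \<Rightarrow> real multiset" where
  "marginal_bids I a = (\<Sum>i\<in>bidders I. replicate_mset (snd (a i)) (fst (a i)))"

definition sorted_bids :: "auction \<Rightarrow> profile \<Rightarrow> real list" where
  "sorted_bids I a = rev (sorted_list_of_multiset (marginal_bids I a))"

text \<open>Ties concern only which bidders receive the units, not the multiset of winning bids, so a
  tie-breaking rule is exactly a choice, for every profile, of an allocation whose multiset of
  winning bids consists of the \<open>k\<close> highest marginal bids (all of them if there are fewer).\<close>

definition allocates_to_highest :: "auction \<Rightarrow> profile \<Rightarrow> bool" where
  "allocates_to_highest I a \<longleftrightarrow>
     (\<forall>i\<in>bidders I. alloc I a i \<le> snd (a i)) \<and>
     (\<Sum>i\<in>bidders I. replicate_mset (alloc I a i) (fst (a i)))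
       = mset (take (num_units I) (sorted_bids I a))"

definition valid_valuation :: "nat \<Rightarrow> (nat \<Rightarrow> real) \<Rightarrow> bool" where
  "valid_valuation k f \<longleftrightarrow>
     f 0 = 0 \<and> (\<forall>j\<le>k. 0 \<le> f j) \<and>
     (\<forall>j. 1 \<le> j \<and> j < k \<longrightarrow> f (j + 1) - f j \<le> f j - f (j - 1))"

definition valid_auction :: "auction \<Rightarrow> bool" where
  "valid_auction I \<longleftrightarrow>
     2 \<le> num_bidders I \<and> 1 \<le> num_units I \<and>
     (\<forall>i\<in>bidders I. valid_valuation (num_units I) (val I i)) \<and>
     (\<forall>a\<in>profiles I. allocates_to_highest I a)"

text \<open>The list index starts at 0, so position \<open>k\<close> holds the \<open>(k+1)\<close>-st highest marginal bid.\<close>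

definition highest_losing_bid :: "auction \<Rightarrow> profile \<Rightarrow> real" where
  "highest_losing_bid I a =
     (if num_units I < length (sorted_bids I a) then sorted_bids I a ! num_units I else 0)"

definition payment :: "auction \<Rightarrow> profile \<Rightarrow> nat \<Rightarrow> real" where
  "payment I a i = highest_losing_bid I a * real (alloc I a i)"

definition utility :: "auction \<Rightarrow> profile \<Rightarrow> nat \<Rightarrow> real" where
  "utility I a i = val I i (alloc I a i) - payment I a i"

definition pure_Nash :: "auction \<Rightarrow> profile \<Rightarrow> bool" where
  "pure_Nash I a \<longleftrightarrow>
     a \<in> profiles I \<and>
     (\<forall>i\<in>bidders I. \<forall>d\<in>actions I. utility I (a(i := d)) i \<le> utility I a i)"


section \<open>Welfare, no-overbidding and the price of anarchy\<close>

definition LW :: "auction \<Rightarrow> profile \<Rightarrow> real" where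
  "LW I a = (\<Sum>i\<in>bidders I. val I i (alloc I a i))"

definition OPT :: "auction \<Rightarrow> real" where
  "OPT I = Max {\<Sum>i\<in>bidders I. val I i (x i) | x.
     x \<in> bidders I \<rightarrow>\<^sub>E {0..num_units I} \<and> (\<Sum>i\<in>bidders I. x i) \<le> num_units I}"

definition worst_payment :: "auction \<Rightarrow> profile \<Rightarrow> nat \<Rightarrow> real" where
  "worst_payment I a i =
     Sup {payment I (a'(i := a i)) i | a'.
       a' \<in> profiles I \<and> alloc I (a'(i := a i)) i = alloc I a i}"

lemma two_bidders:
  assumes v: "valid_auction I" and i: "i \<in> bidders I" and j: "j \<in> bidders I" "i \<noteq> j"
    and p: "p \<in> profiles I" "p i = (b, q)" "p j = (c, r)"
    and z: "\<forall>l \<in> bidders I - {i, j}. snd (p l) = 0"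
  shows "marginal_bids I p = replicate_mset q b + replicate_mset r c"
    "replicate_mset (alloc I p i) b + replicate_mset (alloc I p j) c
       = mset (take (num_units I) (sorted_bids I p))"
proof -
  have B: "bidders I = insert i (insert j (bidders I - {i, j}))" using i j by auto
  have fin: "finite (bidders I)" unfolding bidders_def by simp
  have S: "(\<Sum>l\<in>bidders I. g l) = g i + g j"
    if "\<And>l. l \<in> bidders I - {i, j} \<Longrightarrow> g l = {#}" for g :: "nat \<Rightarrow> real multiset"
  proof -
    have "(\<Sum>l\<in>bidders I. g l) = (\<Sum>l\<in>{i, j}. g l)"
      using i j fin that by (intro sum.mono_neutral_right) auto
    then show ?thesis using j by simp
  qed
  show "marginal_bids I p = replicate_mset q b + replicate_mset r c"
    unfolding marginal_bids_def using z p by (subst S) auto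
  have A: "allocates_to_highest I p" using v p unfolding valid_auction_def by blast
  then have "alloc I p l = 0" if "l \<in> bidders I - {i, j}" for l
    using z that unfolding allocates_to_highest_def by force
  then have "(\<Sum>l\<in>bidders I. replicate_mset (alloc I p l) (fst (p l)))
    = replicate_mset (alloc I p i) b + replicate_mset (alloc I p j) c"
    using p by (subst S) auto
  then show "replicate_mset (alloc I p i) b + replicate_mset (alloc I p j) c
       = mset (take (num_units I) (sorted_bids I p))"
    using A unfolding allocates_to_highest_def by simp
qed

lemma sorted_two:
  assumes "(c::real) \<le> b"
  shows "rev (sorted_list_of_multiset (replicate_mset q b + replicate_mset r c))
    = replicate q b @ replicate r c"
proof -
  have "sorted_list_of_multiset (replicate_mset q b + replicate_mset r c)
     = sort (replicate r c @ replicate q b)"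
    by (metis mset_append mset_replicate sorted_list_of_multiset_mset union_commute)
  also have "\<dots> = replicate r c @ replicate q b"
    by (rule sorted_sort_id) (use assms in \<open>auto simp: sorted_append\<close>)
  finally show ?thesis by simp
qed

lemma worst_payment_eq:
  assumes v: "valid_auction I" and a: "a \<in> profiles I" and i: "i \<in> bidders I"
  shows "worst_payment I a i = fst (a i) * real (alloc I a i)"
proof -
  define k where "k = num_units I"
  obtain b q where ai: "a i = (b, q)" by (cases "a i")
  define x where "x = alloc I a i"
  have bq: "0 \<le> b" "q \<le> k"
    using a i ai unfolding profiles_def actions_def k_def by (fastforce dest!: PiE_mem)+
  have xq: "x \<le> q" using v a i ai unfolding valid_auction_def allocates_to_highest_def x_def by force
  obtain j where j: "j \<in> bidders I" "i \<noteq> j"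
  proof -
    have "(if i = 1 then 2 else 1) \<in> bidders I"
      using v i unfolding valid_auction_def bidders_def by auto
    then show ?thesis using that by (metis one_neq_zero numeral_One num.distinct(1) numeral_eq_iff)
  qed
  define S where "S = {payment I (a'(i := a i)) i | a'.
       a' \<in> profiles I \<and> alloc I (a'(i := a i)) i = alloc I a i}"
  have prof: "a'(i := a i) \<in> profiles I" if "a' \<in> profiles I" for a'
    using that a i unfolding profiles_def by (auto simp: PiE_iff extensional_def)
  have ub: "s \<le> b * x" if s: "s \<in> S" for s
  proof -
    obtain a' where a': "s = payment I (a'(i := a i)) i" "a' \<in> profiles I" "alloc I (a'(i := a i)) i = x"
      using s unfolding S_def x_def by auto
    define p where "p = a'(i := a i)"
    have P: "allocates_to_highest I p" using v prof[OF a'(2)] unfolding p_def valid_auction_def by blast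
    have s': "s = highest_losing_bid I p * real x" using a' unfolding p_def payment_def by simp
    show ?thesis
    proof (cases "x = 0")
      case False
      have "b \<in># replicate_mset (alloc I p i) (fst (p i))" using False a' ai unfolding p_def by auto
      then have "b \<in># (\<Sum>i\<in>bidders I. replicate_mset (alloc I p i) (fst (p i)))"
        using i by (subst set_mset_sum) (auto simp: bidders_def split: if_splits intro!: bexI[of _ i])
      then have "b \<in> set (take k (sorted_bids I p))"
        using P unfolding allocates_to_highest_def k_def by auto
      then obtain m where m: "m < k" "m < length (sorted_bids I p)" "b = sorted_bids I p ! m"
        by (auto simp: in_set_conv_nth)
      have "highest_losing_bid I p \<le> b"
      proof (cases "k < length (sorted_bids I p)")
        case True
        have "sorted (rev (sorted_bids I p))" unfolding sorted_bids_def by simp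
        then show ?thesis using True m sorted_rev_nth_mono[of "sorted_bids I p" m k]
          unfolding highest_losing_bid_def k_def by auto
      qed (use bq in \<open>simp add: highest_losing_bid_def k_def\<close>)
      then show ?thesis unfolding s' by (intro mult_right_mono) auto
    qed (simp add: s')
  qed
  have bdd: "bdd_above S" using ub by (auto simp: bdd_above_def)
  have own: "payment I a i \<in> S" using a unfolding S_def by (auto intro!: exI[of _ a])
  have key: "highest_losing_bid I p * x \<in> S"
    if "p = (\<lambda>l. if l \<in> bidders I then (if l = i then (b, q) else if l = j then (c, r) else (0,0)) else undefined)"
      "0 \<le> c" "r \<le> k" "alloc I p i = x" for p c r
  proof -
    have "p \<in> profiles I" "p(i := a i) = p" using that bq i ai unfolding profiles_def actions_def k_def
      by auto
    then show ?thesis using that unfolding S_def x_def payment_def by force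
  qed
  have le: "b * x \<le> Sup S"
  proof (cases "x = 0 \<or> b = 0")
    case True
    have "0 \<le> highest_losing_bid I a"
    proof -
      have "0 \<le> y" if "y \<in> set (sorted_bids I a)" for y
      proof -
        have "y \<in># marginal_bids I a" using that unfolding sorted_bids_def by simp
        then obtain l where "l \<in> bidders I" "y = fst (a l)" unfolding marginal_bids_def
          by (subst (asm) set_mset_sum) (auto simp: bidders_def split: if_splits)
        then show ?thesis using a unfolding profiles_def actions_def by (auto dest!: PiE_mem)
      qed
      then show ?thesis unfolding highest_losing_bid_def by simp
    qed
    then have "0 \<le> payment I a i" unfolding payment_def by simp
    then show ?thesis using cSup_upper[OF own bdd] True by auto
  next
    case xb: False
    show ?thesis
    proof (cases "x < q")
      case True
      define p where "p = (\<lambda>l. if l \<in> bidders I then (if l = i then (b, q) else if l = j then (b+1, k-x) else (0,0)) else undefined)"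
      have pp: "p \<in> profiles I" "p i = (b, q)" "p j = (b+1, k-x)"
        "\<forall>l \<in> bidders I - {i, j}. snd (p l) = 0"
        using i j bq unfolding p_def profiles_def actions_def k_def by auto
      note T = two_bidders[OF v i j pp]
      have so: "sorted_bids I p = replicate (k-x) (b+1) @ replicate q b"
        unfolding sorted_bids_def T(1) add.commute[of "replicate_mset q b"] by (rule sorted_two) simp
      have "count (replicate_mset (alloc I p i) b + replicate_mset (alloc I p j) (b+1)) b = x"
        unfolding T(2) so using True bq unfolding k_def by simp
      then have al: "alloc I p i = x" by simp
      have "highest_losing_bid I p = b" unfolding highest_losing_bid_def so
        using True bq unfolding k_def by (auto simp: nth_append)
      then show ?thesis using cSup_upper[OF key[OF p_def _ _ al] bdd] bq by auto
    next
      case False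
      then have xq': "x = q" using xq by simp
      have "c * x \<le> Sup S" if c: "0 < c" "c < b" for c
      proof -
        define p where "p = (\<lambda>l. if l \<in> bidders I then (if l = i then (b, q) else if l = j then (c, k-x+1) else (0,0)) else undefined)"
        have kx: "k - x + 1 \<le> k" using xb xq' bq by auto
        have pp: "p \<in> profiles I" "p i = (b, q)" "p j = (c, k-x+1)"
          "\<forall>l \<in> bidders I - {i, j}. snd (p l) = 0"
          using i j bq c kx unfolding p_def profiles_def actions_def k_def by auto
        note T = two_bidders[OF v i j pp]
        have so: "sorted_bids I p = replicate q b @ replicate (k-x+1) c"
          unfolding sorted_bids_def T(1) by (rule sorted_two) (use c in simp)
        have "count (replicate_mset (alloc I p i) b + replicate_mset (alloc I p j) c) b = x"
          unfolding T(2) so using xq' bq c unfolding k_def by (simp del: replicate_Suc)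
        then have al: "alloc I p i = x" using c by simp
        have "highest_losing_bid I p = c" unfolding highest_losing_bid_def so
          using xq' bq unfolding k_def by (auto simp: nth_append simp del: replicate_Suc)
        then show ?thesis using cSup_upper[OF key[OF p_def _ kx al] bdd] c by auto
      qed
      then have "c \<le> Sup S / x" if "0 < c" "c < b" for c
        using that xb by (simp add: field_simps)
      then have "b \<le> Sup S / x" using xb bq by - (rule dense_le_bounded[of 0], auto)
      then show ?thesis using xb by (simp add: field_simps)
    qed
  qed
  have "Sup S \<le> b * x" using own ub by (intro cSup_least) auto
  then show ?thesis using le S_def ai x_def unfolding worst_payment_def by (metis (lifting) antisym fst_conv)
qed

definition NOB_feasible :: "auction \<Rightarrow> profile \<Rightarrow> bool" where
  "NOB_feasible I a \<longleftrightarrow> (\<Sum>i\<in>bidders I. worst_payment I a i) \<le> LW I a"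

text \<open>In \<^typ>\<open>ereal\<close> a positive number divided by \<open>0\<close> is \<open>\<infinity>\<close> and \<open>0 / 0 = 0\<close>, so instances
  with \<open>OPT = 0\<close> contribute only the value \<open>0\<close> to the supremum.\<close>

definition price_of_anarchy :: ereal where
  "price_of_anarchy =
     Sup {ereal (OPT I) / ereal (LW I a) | I a.
       valid_auction I \<and> pure_Nash I a \<and> NOB_feasible I a}"

end

theory Submission
  imports Defs
begin

text \<open>One bidder values every unit at 1 and bids \<open>(0, m)\<close>; the others value nothing, yet each
  demands one of the remaining \<open>k - m\<close> units. If their bids are \<open>1 - m/j\<close> for \<open>j = m + 1, \<dots>, k\<close>,
  then winning \<open>j\<close> units would earn the first bidder at most \<open>j - j (1 - m/j) = m\<close>, which is the
  present utility since the price is 0. So this is an equilibrium of welfare \<open>m\<close> against an optimum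
  of \<open>k\<close>. It is NOB-feasible if \<open>k - m - m (1/(m+1) + \<dots> + 1/k) \<le> m\<close>, which for large \<open>m\<close>
  amounts to \<open>r < 2 + ln r\<close> with \<open>r = k/m\<close>; and \<open>- W(-exp (-2))\<close> is the solution
  of \<open>r = 2 + ln r\<close> above 1.\<close>

section \<open>Allocations and the highest losing bid\<close>

text \<open>Induction on \<open>A\<close>: the new index \<open>j\<close> takes the part of
  \<open>M\<close> that it shares with its own copies, and what remains, \<open>M - ?R\<close>, must
  come from the other indices.\<close>

lemma submultiset_of_replicates:
  assumes "finite A" "M \<subseteq># (\<Sum>i\<in>A. replicate_mset (q i) (b i))"
  shows "\<exists>x. (\<forall>i\<in>A. x i \<le> q i) \<and> (\<Sum>i\<in>A. replicate_mset (x i) (b i)) = M"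
  using assms
proof (induction A arbitrary: M rule: finite_induct)
  case (insert j A)
  let ?R = "replicate_mset (q j) (b j)"
  have "M - ?R \<subseteq># (\<Sum>i\<in>A. replicate_mset (q i) (b i))"
    using insert by (simp add: subset_eq_diff_conv add.commute)
  then obtain x where x: "\<forall>i\<in>A. x i \<le> q i" "(\<Sum>i\<in>A. replicate_mset (x i) (b i)) = M - ?R"
    using insert.IH by blast
  obtain y where y: "y \<le> q j" "M \<inter># ?R = replicate_mset y (b j)"
    using msubseteq_replicate_msetE[OF subset_mset.inf_le2] by metis
  have "(\<Sum>i\<in>A. replicate_mset ((x(j := y)) i) (b i)) = (\<Sum>i\<in>A. replicate_mset (x i) (b i))"
    using insert.hyps by (intro sum.cong) auto
  moreover have "M \<inter># ?R + (M - ?R) = M"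
    by (simp add: multiset_eq_iff)
  ultimately have "(\<Sum>i\<in>insert j A. replicate_mset ((x(j := y)) i) (b i)) = M"
    using insert.hyps x y by simp
  then show ?case using x y by (intro exI[of _ "x(j := y)"]) auto
qed simp

lemma finite_bidders [simp]: "finite (bidders I)"
  by (simp add: bidders_def)

lemma mset_sorted_bids: "mset (sorted_bids I a) = marginal_bids I a"
  by (simp add: sorted_bids_def)

lemma length_sorted_bids: "length (sorted_bids I a) = (\<Sum>i\<in>bidders I. snd (a i))"
  by (simp only: size_mset[symmetric] mset_sorted_bids) (simp add: marginal_bids_def)

text \<open>Supplies a tie-breaking rule, so that an instance with given valuations can be completed
  to a valid auction.\<close>

lemma ex_allocation_to_highest:
  "\<exists>x. (\<forall>i\<in>bidders I. x i \<le> snd (a i)) \<and>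
     (\<Sum>i\<in>bidders I. replicate_mset (x i) (fst (a i))) = mset (take k (sorted_bids I a))"
proof (rule submultiset_of_replicates)
  have "mset (take k (sorted_bids I a)) \<subseteq># mset (sorted_bids I a)"
    by (metis append_take_drop_id mset_append mset_subset_eq_add_left)
  then show "mset (take k (sorted_bids I a))
      \<subseteq># (\<Sum>i\<in>bidders I. replicate_mset (snd (a i)) (fst (a i)))"
    by (simp add: mset_sorted_bids marginal_bids_def)
qed simp

lemma sum_alloc:
  assumes "allocates_to_highest I a"
  shows "(\<Sum>i\<in>bidders I. alloc I a i) = min (num_units I) (\<Sum>i\<in>bidders I. snd (a i))"
proof -
  have "size (\<Sum>i\<in>bidders I. replicate_mset (alloc I a i) (fst (a i)))
      = size (mset (take (num_units I) (sorted_bids I a)))"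
    using assms unfolding allocates_to_highest_def by simp
  then show ?thesis by (simp add: length_sorted_bids min.commute)
qed

text \<open>A single bidder left short would push the number of units awarded below total demand,
  contradicting \<open>sum_alloc\<close>.\<close>

lemma alloc_eq_demand:
  assumes A: "allocates_to_highest I a" and le: "(\<Sum>i\<in>bidders I. snd (a i)) \<le> num_units I"
    and i: "i \<in> bidders I"
  shows "alloc I a i = snd (a i)"
proof (rule ccontr)
  assume "alloc I a i \<noteq> snd (a i)"
  then have "(\<Sum>i\<in>bidders I. alloc I a i) < (\<Sum>i\<in>bidders I. snd (a i))"
    using A i by (intro sum_strict_mono_ex1) (force simp: allocates_to_highest_def)+
  then show False using sum_alloc[OF A] le by simp
qed

text \<open>Cancelling the winning copies from all marginal bids shows that the unserved copies are
  exactly the entries of the sorted list from position \<open>k\<close> on. The list is decreasing,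
  so its entry at \<open>k\<close> dominates them.\<close>

lemma unserved_bid_le_highest_losing_bid:
  assumes A: "allocates_to_highest I a" and i: "i \<in> bidders I" and lt: "alloc I a i < snd (a i)"
  shows "fst (a i) \<le> highest_losing_bid I a"
proof -
  define s k where "s = sorted_bids I a" and "k = num_units I"
  have "mset (take k s) + mset (drop k s) = marginal_bids I a"
    by (simp add: s_def mset_sorted_bids flip: mset_append)
  also have "\<dots> = (\<Sum>i\<in>bidders I. replicate_mset (alloc I a i) (fst (a i))
      + replicate_mset (snd (a i) - alloc I a i) (fst (a i)))"
    unfolding marginal_bids_def using A
    by (intro sum.cong) (auto simp: multiset_eq_iff allocates_to_highest_def)
  finally have "mset (drop k s)
      = (\<Sum>i\<in>bidders I. replicate_mset (snd (a i) - alloc I a i) (fst (a i)))"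
    using A by (simp add: sum.distrib allocates_to_highest_def s_def k_def)
  then have "fst (a i) \<in># mset (drop k s)"
    using i lt by (auto simp: set_mset_sum intro!: bexI[of _ i])
  then obtain l where "l < length (drop k s)" "drop k s ! l = fst (a i)"
    by (auto simp: in_set_conv_nth)
  then have l: "k + l < length s" "fst (a i) = s ! (k + l)" by simp_all
  have "sorted (rev s)" by (simp add: s_def sorted_bids_def)
  then have "s ! (k + l) \<le> s ! k" using l by (intro sorted_rev_nth_mono) auto
  then show ?thesis using l by (simp add: highest_losing_bid_def s_def k_def)
qed

lemma highest_losing_bid_nonneg:
  assumes "a \<in> profiles I"
  shows "0 \<le> highest_losing_bid I a"
proof -
  have "0 \<le> y" if "y \<in> set (sorted_bids I a)" for y
  proof -
    have "y \<in># marginal_bids I a" using that by (simp flip: mset_sorted_bids)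
    then obtain l where "l \<in> bidders I" "y = fst (a l)"
      by (auto simp: marginal_bids_def set_mset_sum split: if_splits)
    then show ?thesis using assms by (auto simp: profiles_def actions_def dest!: PiE_mem)
  qed
  then show ?thesis by (simp add: highest_losing_bid_def)
qed

lemma highest_losing_bid_eq_0:
  assumes "(\<Sum>i\<in>bidders I. snd (a i)) \<le> num_units I"
  shows "highest_losing_bid I a = 0"
  using assms by (simp add: highest_losing_bid_def length_sorted_bids)

lemma welfare_le_OPT:
  assumes "x \<in> bidders I \<rightarrow>\<^sub>E {0..num_units I}" "(\<Sum>i\<in>bidders I. x i) \<le> num_units I"
  shows "(\<Sum>i\<in>bidders I. val I i (x i)) \<le> OPT I"
  unfolding OPT_def
proof (rule Max_ge)
  have "finite ((\<lambda>x. \<Sum>i\<in>bidders I. val I i (x i)) ` (bidders I \<rightarrow>\<^sub>E {0..num_units I}))"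
    by (intro finite_imageI finite_PiE) auto
  then show "finite {\<Sum>i\<in>bidders I. val I i (x i) | x.
     x \<in> bidders I \<rightarrow>\<^sub>E {0..num_units I} \<and> (\<Sum>i\<in>bidders I. x i) \<le> num_units I}"
    by (rule rev_finite_subset) auto
qed (use assms in blast)

section \<open>The equilibrium\<close>

text \<open>Reduces the auction to an inequality in \<open>m\<close> and \<open>k\<close>. The
  assumption \<open>nob\<close> is the NOB condition of the equilibrium: the first bidder bids 0,
  and each other bidder wins one unit, so its worst payment is its bid.\<close>

lemma ratio_le_price_of_anarchy:
  assumes m: "1 \<le> m" "m < k" and nob: "(\<Sum>j=m+1..k. 1 - real m / real j) \<le> real m"
  shows "ereal (real k / real m) \<le> price_of_anarchy"
proof -
  define n where "n = k - m + 1"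
  \<comment> \<open>The allocation of \<open>J\<close> is a dummy. Bidders and sorted bids do not
    depend on it, so a rule \<open>X\<close> found for \<open>J\<close> also serves
    \<open>I\<close>.\<close>
  define J where "J = \<lparr>num_bidders = n, num_units = k,
    val = (\<lambda>i j. if i = 1 then real j else 0), alloc = (\<lambda>_ _. 0)\<rparr>"
  obtain X where X: "\<And>a. (\<forall>i\<in>bidders J. X a i \<le> snd (a i)) \<and>
     (\<Sum>i\<in>bidders J. replicate_mset (X a i) (fst (a i))) = mset (take k (sorted_bids J a))"
    using ex_allocation_to_highest[of J _ k] by metis
  define I where "I = J\<lparr>alloc := X\<rparr>"
  have I [simp]: "bidders I = {1..n}" "num_units I = k" "num_bidders I = n"
      "val I = (\<lambda>i j. if i = 1 then real j else 0)" "alloc I = X"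
    by (auto simp: I_def J_def bidders_def)
  have bJ: "bidders J = bidders I" by (simp add: I_def bidders_def)
  have "sorted_bids I = sorted_bids J"
    by (intro ext) (simp add: sorted_bids_def marginal_bids_def bJ)
  then have high: "allocates_to_highest I a" for a
    using X[of a] unfolding allocates_to_highest_def bJ by simp
  have n: "2 \<le> n" "n = k - m + 1" using m by (auto simp: n_def)
  have valid: "valid_auction I"
    using n m high by (auto simp: valid_auction_def valid_valuation_def)
  have split: "(\<Sum>i=1..n. f i) = f 1 + (\<Sum>i=2..n. f i)" for f :: "nat \<Rightarrow> 'b::comm_monoid_add"
    using n by (subst sum.atLeast_Suc_atMost) (auto simp: numeral_2_eq_2)

  define p where "p j = 1 - real m / real j" for j
  have p_nonneg: "0 \<le> p j" if "m \<le> j" for j using that m by (simp add: p_def)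
  have p_mono: "p j \<le> p l" if "m \<le> j" "j \<le> l" for j l
    using that m by (auto simp: p_def intro!: divide_left_mono)
  \<comment> \<open>Bidder \<open>i \<ge> 2\<close> takes the role of \<open>j = m + i - 1\<close>.\<close>
  define a :: profile where "a = (\<lambda>i. if i = 1 then (0, m)
    else if i \<in> {2..n} then (p (m + i - 1), 1) else undefined)"
  have prof: "a \<in> profiles I"
    using m n by (auto simp: a_def profiles_def actions_def intro!: p_nonneg)
  have a1: "a 1 = (0, m)" by (simp add: a_def)
  have snd_a: "(\<Sum>i=2..n. snd (a i)) = k - m"
  proof -
    have "(\<Sum>i=2..n. snd (a i)) = (\<Sum>i=2..n. 1)" by (intro sum.cong) (auto simp: a_def)
    then show ?thesis using n by simp
  qed
  \<comment> \<open>Demand exactly exhausts supply: everybody is served in full, whatever the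
    tie-breaking, and the price is 0.\<close>
  have demand: "(\<Sum>i\<in>bidders I. snd (a i)) = k"
    unfolding I split using snd_a m a1 by simp
  have won: "X a i = snd (a i)" if "i \<in> {1..n}" for i
    using alloc_eq_demand[OF high, of a i] demand that by simp
  have price: "highest_losing_bid I a = 0" using demand by (intro highest_losing_bid_eq_0) simp
  have "1 \<in> {1..n}" using n(1) by simp
  then have X1: "X a 1 = m" by (simp only: won a1 snd_conv)

  have LW: "LW I a = m"
    unfolding LW_def I split using X1 by simp
  have "worst_payment I a i = fst (a i) * real (snd (a i))" if "i \<in> {1..n}" for i
    using worst_payment_eq[OF valid prof, of i] won that by simp
  then have "(\<Sum>i\<in>bidders I. worst_payment I a i) = (\<Sum>i=1..n. fst (a i) * real (snd (a i)))"
    unfolding I by (intro sum.cong) auto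
  also have "\<dots> = (\<Sum>i=2..n. p (m + i - 1))"
  proof -
    have "(\<Sum>i=2..n. fst (a i) * real (snd (a i))) = (\<Sum>i=2..n. p (m + i - 1))"
      by (intro sum.cong) (auto simp: a_def)
    then show ?thesis unfolding split using a1 by simp
  qed
  also have "\<dots> = (\<Sum>j=m+1..k. p j)"
    using n m by (intro sum.reindex_bij_witness[of _ "\<lambda>j. j - m + 1" "\<lambda>i. m + i - 1"]) auto
  finally have feasible: "NOB_feasible I a"
    using nob by (simp add: NOB_feasible_def LW p_def)

  have "utility I (a(i := d)) i \<le> utility I a i" if i: "i \<in> {1..n}" and d: "d \<in> actions I" for i d
  proof -
    define a' where "a' = a(i := d)"
    have prof': "a' \<in> profiles I"
      using prof d i unfolding a'_def profiles_def by (auto simp: PiE_iff extensional_def)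
    define h where "h = highest_losing_bid I a'"
    have h: "0 \<le> h" unfolding h_def by (rule highest_losing_bid_nonneg[OF prof'])
    show ?thesis
    proof (cases "i = 1")
      \<comment> \<open>These bidders value nothing and pay 0 at present; a deviation can only add a
        nonnegative payment.\<close>
      case False
      then show ?thesis using h
        by (simp add: utility_def payment_def price flip: a'_def h_def)
    next
      case True
      define x where "x = X a' 1"
      have "real x - h * real x \<le> real m"
      proof (cases "x \<le> m")
        case True
        then show ?thesis using h by (smt (verit) mult_nonneg_nonneg of_nat_0_le_iff of_nat_mono)
      next
        case False
        have xk: "x \<le> k"
        proof -
          have "x \<le> (\<Sum>i\<in>bidders I. alloc I a' i)"
            unfolding x_def I split by simp
          then show ?thesis using sum_alloc[OF high, of a'] by simp
        qed
        \<comment> \<open>There are \<open>k - x + 1\<close> bidders in this range but only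
          \<open>k - x\<close> units left for them, so one loses. As
          \<open>m + l - 1 \<ge> x\<close>, its bid is at least \<open>p x\<close>, which bounds the
          price from below.\<close>
        have "\<exists>l\<in>{x - m + 1..n}. X a' l = 0"
        proof (rule ccontr)
          assume "\<not> ?thesis"
          then have "(\<Sum>l=x - m + 1..n. 1) \<le> (\<Sum>l=x - m + 1..n. X a' l)"
by (intro sum_mono) (auto simp: Suc_le_eq)
          also have "\<dots> \<le> (\<Sum>l=2..n. X a' l)"
            using False by (intro sum_mono2) auto
          finally have "k - x + 1 \<le> (\<Sum>l=2..n. X a' l)"
            using xk False by (simp add: n_def)
          then have "k < (\<Sum>i\<in>bidders I. alloc I a' i)"
            unfolding I split x_def[symmetric] by linarith
          then show False using sum_alloc[OF high, of a'] by simp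
        qed
        then obtain l where l: "x - m + 1 \<le> l" "l \<le> n" "X a' l = 0" by auto
        have "2 \<le> l" using l False by linarith
        then have a'l: "a' l = (p (m + l - 1), 1)"
          using True \<open>l \<le> n\<close> by (simp add: a'_def a_def)
        have "p (m + l - 1) \<le> h"
          using unserved_bid_le_highest_losing_bid[OF high, of l a'] l a'l \<open>2 \<le> l\<close>
          by (simp add: h_def)
        moreover have "p x \<le> p (m + l - 1)" using l False by (intro p_mono) auto
        ultimately have "p x * real x \<le> h * real x" by (intro mult_right_mono) auto
        \<comment> \<open>The bids are calibrated so that the payment eats up the whole gain over
          \<open>m\<close>.\<close>
        moreover have "p x * real x = real x - real m" using False m by (simp add: p_def field_simps)
        ultimately show ?thesis by simp
      qed
      moreover have "utility I a' 1 = real x - h * real x"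
        by (simp add: utility_def payment_def h_def x_def)
      moreover have "utility I a 1 = real m"
        using X1 by (simp add: utility_def payment_def price)
      ultimately show ?thesis using True unfolding a'_def by metis
    qed
  qed
  then have Nash: "pure_Nash I a" using prof by (simp add: pure_Nash_def)

  have "(\<Sum>i\<in>bidders I. val I i ((\<lambda>i\<in>{1..n}. if i = 1 then k else 0) i)) \<le> OPT I"
    by (rule welfare_le_OPT) (auto simp: split)
  then have "real k \<le> OPT I" unfolding I split using n by simp
  then have "ereal (real k / real m) \<le> ereal (OPT I) / ereal (LW I a)"
    using m by (simp add: LW divide_right_mono)
  also have "\<dots> \<le> price_of_anarchy"
    unfolding price_of_anarchy_def by (intro Sup_upper) (use valid Nash feasible in blast)
  finally show ?thesis .
qed

section \<open>The optimal ratio\<close>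

text \<open>The bound \<open>ln (1 + 1/j) \<le> 1/j\<close>, telescoped over
  \<open>j\<close>.\<close>

lemma ln_le_sum_inverse:
  assumes "m \<le> k"
  shows "ln (real (k + 1) / real (m + 1)) \<le> (\<Sum>j=m+1..k. 1 / real j)"
  using assms
proof (induction k rule: dec_induct)
  case (step k)
  have "ln (real (k + 2) / real (k + 1)) \<le> 1 / real (k + 1)"
    using ln_add_one_self_le_self[of "1 / real (k + 1)"] by (simp add: field_simps)
  moreover have "ln (real (k + 2) / real (m + 1))
      = ln (real (k + 1) / real (m + 1)) + ln (real (k + 2) / real (k + 1))"
    by (subst ln_mult_pos[symmetric]) auto
  ultimately show ?case using step by simp
qed simp

lemma Lambert_Wm1_fixed_point:
  defines "w \<equiv> - Lambert_Wm1 (- exp (-2))"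
  shows "1 \<le> w" "w = 2 + ln w"
proof -
  have "Lambert_Wm1 (- exp (-2)) \<le> -1 \<and>
      Lambert_Wm1 (- exp (-2)) * exp (Lambert_Wm1 (- exp (-2))) = - exp (-2)"
    unfolding Lambert_Wm1_def by (rule theI'[OF Lambert_Wm1_ex1])
  then have w: "1 \<le> w" "w * exp (- w) = exp (-2)" by (auto simp: w_def)
  \<comment> \<open>Taking logarithms gives \<open>ln w - w = -2\<close>.\<close>
  from arg_cong[OF w(2), of ln] show "w = 2 + ln w" using w(1) by (simp add: ln_mult_pos)
  show "1 \<le> w" by fact
qed

text \<open>Scaling numerator and denominator of \<open>r\<close> by a large factor keeps
  \<open>k/m = r\<close> while \<open>(k + 1)/(m + 1)\<close> tends to \<open>r\<close>. The strict
  inequality leaves room for this error.\<close>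

lemma rational_le_price_of_anarchy:
  assumes "1 < r" "r < 2 + ln r" "r \<in> \<rat>"
  shows "ereal r \<le> price_of_anarchy"
proof -
  obtain a b where ab: "b \<noteq> 0" "\<bar>r\<bar> = real a / real b"
    using Rats_abs_nat_div_natE[OF assms(3)] by metis
  have r: "r = real a / real b" using ab assms(1) by simp
  have "b < a" using ab assms(1) unfolding r by (simp add: less_divide_eq)
  have frac: "(real a + inverse (real s)) / (real b + inverse (real s))
      = real (a * s + 1) / real (b * s + 1)" if "0 < s" for s
    using that by (simp add: inverse_eq_divide divide_simps add.commute)
  have "(\<lambda>t. (real a + inverse (real (Suc t))) / (real b + inverse (real (Suc t))))
      \<longlonglongrightarrow> (real a + 0) / (real b + 0)"
    using ab by (intro tendsto_intros LIMSEQ_inverse_real_of_nat) auto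
  then have "(\<lambda>t. real (a * Suc t + 1) / real (b * Suc t + 1)) \<longlonglongrightarrow> r"
    unfolding frac[OF zero_less_Suc] r by simp
  then have "(\<lambda>t. 2 + ln (real (a * Suc t + 1) / real (b * Suc t + 1))) \<longlonglongrightarrow> 2 + ln r"
    using assms(1) by (intro tendsto_intros) auto
  then have "eventually (\<lambda>t. r < 2 + ln (real (a * Suc t + 1) / real (b * Suc t + 1))) sequentially"
    using assms(2) by (rule order_tendstoD)
  then obtain t where t: "r < 2 + ln (real (a * Suc t + 1) / real (b * Suc t + 1))"
    by (auto simp: eventually_sequentially)
  define m k where "m = b * Suc t" and "k = a * Suc t"
  have mk: "1 \<le> m" "m < k"
    using ab mult_strict_right_mono[OF \<open>b < a\<close>, of "Suc t"]
    unfolding m_def k_def by auto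
  have rmk: "real k / real m = r"
    unfolding m_def k_def r of_nat_mult by (rule mult_divide_mult_cancel_right) simp
  have "r < 2 + (\<Sum>j=m+1..k. 1 / real j)"
    using t ln_le_sum_inverse[of m k] mk unfolding m_def k_def by linarith
  then have "real m * (real k / real m) \<le> real m * (2 + (\<Sum>j=m+1..k. 1 / real j))"
    unfolding rmk by (intro mult_left_mono) auto
  then have "real k - real m - (\<Sum>j=m+1..k. real m / real j) \<le> real m"
    using mk by (simp add: distrib_left sum_distrib_left)
  then have "(\<Sum>j=m+1..k. 1 - real m / real j) \<le> real m"
    using mk by (simp add: sum_subtractf of_nat_diff)
  then show ?thesis using ratio_le_price_of_anarchy[OF mk] rmk by simp
qed

theorem theorem5p4:
  shows "ereal (- Lambert_Wm1 (- exp (-2))) \<le> price_of_anarchy"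
proof (rule dense_le)
  define w where "w = - Lambert_Wm1 (- exp (-2))"
  have w: "1 \<le> w" "w = 2 + ln w" using Lambert_Wm1_fixed_point by (auto simp: w_def)
  then have w1: "1 < w" using ln_ge_zero[of w] by linarith
  fix y assume "y < ereal (- Lambert_Wm1 (- exp (-2)))"
  \<comment> \<open>The maximum with 1 ensures that the rational \<open>r\<close> picked between
    \<open>z\<close> and \<open>w\<close> exceeds 1.\<close>
  then have "max y 1 < ereal w" using w1 by (simp add: w_def one_ereal_def)
  then obtain z where z: "max y 1 < ereal z" "z < w"
    using ereal_dense2 by (metis ereal_less_eq(3) less_ereal.simps(1))
  then obtain r where r: "r \<in> \<rat>" "z < r" "r < w" using Rats_dense_in_real by blast
  have r1: "1 < r" using z r by (simp add: one_ereal_def)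
  \<comment> \<open>Since \<open>r > 1\<close>, the logarithm grows by less than
    \<open>w - r\<close> from \<open>r\<close> to \<open>w\<close>; with \<open>w = 2 + ln w\<close>
    this yields \<open>r < 2 + ln r\<close>.\<close>
  have "ln w - ln r \<le> (w - r) / r"
    using ln_le_minus_one[of "w / r"] r1 r by (simp add: ln_div diff_divide_distrib)
  also have "\<dots> < (w - r) / 1" using r r1 by (intro divide_strict_left_mono) auto
  finally have "ereal r \<le> price_of_anarchy"
    using w r r1 by (intro rational_le_price_of_anarchy) auto
  moreover have "y \<le> ereal r" using z(1) r(2)
    by (metis less_ereal.simps(1) less_imp_le less_trans max_less_iff_conj)
  ultimately show "y \<le> price_of_anarchy" by simp
qed

end
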